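(* Let $\varepsilon>0$, let $C$ be the least odd integer greater than $\left(\frac{2}{\varepsilon}\ln\frac{1}{\varepsilon}\right)^2$, and let $\beta=\beta(n)$ satisfy $0<\beta<\frac{1}{n^{C+3}}$. Then every $(\lceil (C+2)\log_2 n\rceil,\beta)$-wise independent set $\mathcal A\subseteq\{0,1\}^*$ is $\varepsilon$-rich.
   Context: For $k=k(n)$ and $\beta=\beta(n)>0$, a set $\mathcal A\subseteq\{0,1\}^*$ is $(k,\beta)$-wise independent if for all sufficiently large $n$, writing $\mathcal A_n=\mathcal A\cap\{0,1\}^n$, for every index set $S\subseteq\{1,\ldots,n\}$ with $|S|\leq k$ and every $\mathbf{c}\in\{0,1\}^n$, $\left|\frac{|\mathcal A_n^S(\mathbf{c})|}{|\mathcal A_n|}-\frac{1}{2^{|S|}}\right|\leq\beta$, where $\mathcal A_n^S(\mathbf{c})=\{\mathbf{a}\in\mathcal A_n:\ a_i=c_i\ \text{for all } i\in S\}$. For $\eta>0$, a set $A\subseteq\{0,1\}^*$ is $\eta$-rich if for all sufficiently large $n$, for every index set $I\subseteq\{1,\ldots,n\}$, every partition $\{R_1,\ldots,R_r\}$ of $I$ ($r\geq0$) with $\prod_{j=1}^r(1-2^{-|R_j|})\geq\eta$, every $Q\subseteq\{1,\ldots,n\}\setminus I$ with $|Q|\leq\log_2 n$, and every $\mathbf{c}\in\{0,1\}^n$, there exists $\mathbf{a}\in A\cap\{0,1\}^n$ with $a_i=c_i$ for all $i\in Q$ and, for every $j\in\{1,\ldots,r\}$, some $i\in R_j$ with $a_i\neq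 c_i$. *)

theory Defs
  imports Complex_Main "HOL-Library.Disjoint_Sets"
begin

text \<open>
  Binary strings are Boolean lists; the positions \<open>1, \<dots>, n\<close> are shifted to
  \<open>0, \<dots>, n - 1\<close>, so that position \<open>i\<close> of \<open>a\<close> is \<open>a ! i\<close>.
\<close>

definition slice :: "bool list set \<Rightarrow> nat \<Rightarrow> bool list set" where
  "slice A n = {a \<in> A. length a = n}"

definition agreeing :: "bool list set \<Rightarrow> nat \<Rightarrow> nat set \<Rightarrow> bool list \<Rightarrow> bool list set" where
  "agreeing A n S c = {a \<in> slice A n. \<forall>i\<in>S. a ! i = c ! i}"

text \<open>
  If \<open>slice A n\<close> is empty, the quotient below is \<open>0 / 0 = 0\<close>, and the condition for
  \<open>S = {}\<close> then fails whenever \<open>\<beta> n < 1\<close>.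
\<close>

definition wise_independent ::
  "(nat \<Rightarrow> nat) \<Rightarrow> (nat \<Rightarrow> real) \<Rightarrow> bool list set \<Rightarrow> bool" where
  "wise_independent k \<beta> A \<longleftrightarrow>
    (\<forall>\<^sub>F n in sequentially. \<forall>S c. S \<subseteq> {..<n} \<longrightarrow> card S \<le> k n \<longrightarrow> length c = n \<longrightarrow>
      \<bar>real (card (agreeing A n S c)) / real (card (slice A n)) - 1 / 2 ^ card S\<bar> \<le> \<beta> n)"

definition rich :: "real \<Rightarrow> bool list set \<Rightarrow> bool" where
  "rich \<eta> A \<longleftrightarrow>
    (\<forall>\<^sub>F n in sequentially. \<forall>I P Q c.
      I \<subseteq> {..<n} \<longrightarrow> partition_on I P \<longrightarrow> (\<Prod>R\<in>P. 1 - 1 / 2 ^ card R) \<ge> \<eta> \<longrightarrow>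
      Q \<subseteq> {..<n} - I \<longrightarrow> real (card Q) \<le> log 2 (real n) \<longrightarrow> length c = n \<longrightarrow>
      (\<exists>a\<in>slice A n. (\<forall>i\<in>Q. a ! i = c ! i) \<and> (\<forall>R\<in>P. \<exists>i\<in>R. a ! i \<noteq> c ! i)))"

end

theory Submission imports Defs begin

text \<open>
  Cut every block down to at most \<open>t = \<lceil>log\<^sub>2 n\<rceil>\<close> positions, and let \<open>p\<^sub>R\<close> be the
  probability that a uniform string agrees with \<open>c\<close> on the cut block \<open>R\<close>. Fewer than \<open>n / t\<close>
  blocks get cut, so cutting adds at most \<open>1 / t\<close> to \<open>\<Sum> p\<^sub>R\<close> and \<open>\<Prod> (1 - p\<^sub>R) \<ge> \<epsilon> / 2\<close> persists.
  The Bonferroni lower bound truncated at the odd level \<open>C\<close> involves only events that depend on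
  at most \<open>(C + 2) log\<^sub>2 n\<close> positions; under the uniform distribution it loses at most the
  elementary symmetric polynomial \<open>e\<^bsub>C+1\<^esub>(p) \<le> (\<Sum> p\<^sub>R)\<^bsup>C+1\<^esup> / (C+1)!\<close>, which is at most \<open>\<epsilon> / 4\<close> by
  the choice of \<open>C\<close> and \<open>m\<^sup>m \<le> (m!)\<^sup>2\<close>. The remaining \<open>\<epsilon> / (4n)\<close> outweighs the
  total error \<open>(C + 1) n\<^sup>C \<beta>(n)\<close> of passing to \<open>A\<close>.
\<close>

section \<open>Elementary symmetric polynomials and the Bonferroni inequalities\<close>

definition esym :: "'a set \<Rightarrow> ('a \<Rightarrow> real) \<Rightarrow> nat \<Rightarrow> real" where
  "esym P p m = (\<Sum>K | K \<subseteq> P \<and> card K = m. prod p K)"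

lemma esym_0:
  assumes "finite P"
  shows "esym P p 0 = 1"
proof -
  have "{K. K \<subseteq> P \<and> card K = 0} = {{}}"
    using assms by (auto dest: finite_subset)
  then show ?thesis by (simp add: esym_def)
qed

lemma esym_empty_Suc: "esym {} p (Suc m) = 0"
proof -
  have "{K. K \<subseteq> {} \<and> card K = Suc m} = ({} :: 'a set set)" by auto
  then show ?thesis by (simp add: esym_def)
qed

text \<open>Sets of size \<open>Suc m\<close> that avoid \<open>x\<close> give the first summand;
  those containing \<open>x\<close> arise from sets of size \<open>m\<close> through the injection
  \<open>insert x\<close>.\<close>

lemma esym_insert_Suc:
  assumes "finite P" "x \<notin> P"
  shows "esym (insert x P) p (Suc m) = esym P p (Suc m) + p x * esym P p m"
proof -
  let ?U = "{K. K \<subseteq> P \<and> card K = Suc m}" and ?V = "{K. K \<subseteq> P \<and> card K = m}"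
  have fin: "finite K" if "K \<subseteq> P" for K using that assms finite_subset by blast
  have eq: "{K. K \<subseteq> insert x P \<and> card K = Suc m} = ?U \<union> insert x ` ?V" (is "?W = _")
  proof (intro equalityI subsetI)
    fix K assume K: "K \<in> ?W"
    show "K \<in> ?U \<union> insert x ` ?V"
    proof (cases "x \<in> K")
      case True
      then have "K = insert x (K - {x})" "K - {x} \<in> ?V" using K by auto
      then show ?thesis by blast
    qed (use K in auto)
  next
    fix K assume "K \<in> ?U \<union> insert x ` ?V"
    then show "K \<in> ?W"
    proof
      assume "K \<in> insert x ` ?V"
      then obtain L where "L \<in> ?V" "K = insert x L" by blast
      then show ?thesis using assms fin[of L] by (auto simp: card_insert_if)
    qed auto
  qed
  have inj: "inj_on (insert x) ?V"
    using assms by (auto simp: inj_on_def)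
  have "esym (insert x P) p (Suc m) = sum (prod p) ?U + sum (prod p) (insert x ` ?V)"
    unfolding esym_def eq by (rule sum.union_disjoint) (use assms in auto)
  also have "sum (prod p) (insert x ` ?V) = (\<Sum>K\<in>?V. prod p (insert x K))"
    using inj by (simp add: sum.reindex)
  also have "\<dots> = (\<Sum>K\<in>?V. p x * prod p K)"
    using assms fin by (intro sum.cong refl prod.insert) auto
  finally show ?thesis by (simp add: esym_def sum_distrib_left)
qed

text \<open>
  Applied both to indicators, where the product is itself an indicator and the inequality is
  used string by string, and to the block probabilities.
\<close>
lemma bonferroni:
  fixes p :: "'a \<Rightarrow> real"
  assumes "finite P" "\<And>x. x \<in> P \<Longrightarrow> 0 \<le> p x \<and> p x \<le> 1"
  shows "0 \<le> (-1) ^ m * ((\<Sum>k\<le>m. (-1) ^ k * esym P p k) - (\<Prod>x\<in>P. 1 - p x))"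
  using assms
proof (induction P arbitrary: m rule: finite_induct)
  case empty
  have "(\<Sum>k\<le>m. (-1) ^ k * esym {} p k) = 1"
    by (simp add: sum.atMost_shift esym_0 esym_empty_Suc)
  then show ?case by simp
next
  case (insert x P)
  let ?E = "\<lambda>P m. \<Sum>k\<le>m. (-1) ^ k * esym P p k" and ?\<Pi> = "\<Prod>x\<in>P. 1 - p x"
  show ?case
  proof (cases m)
    case 0
    have "(\<Prod>x\<in>insert x P. 1 - p x) \<le> 1"
      using insert.prems by (intro prod_le_1) auto
    then show ?thesis using 0 insert by (simp add: esym_0)
  next
    case (Suc l)
    have "?E (insert x P) (Suc l) = 1 + (\<Sum>k\<le>l. (-1) ^ Suc k * (esym P p (Suc k) + p x * esym P p k))"
      using insert by (subst sum.atMost_Suc_shift) (simp add: esym_0 esym_insert_Suc)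
    also have "\<dots> = 1 + (\<Sum>k\<le>l. (-1) ^ Suc k * esym P p (Suc k)) - p x * ?E P l"
      by (simp add: sum_distrib_left algebra_simps sum.distrib sum_negf sum_subtractf)
    also have "1 + (\<Sum>k\<le>l. (-1) ^ Suc k * esym P p (Suc k)) = ?E P (Suc l)"
      using insert by (subst sum.atMost_Suc_shift[where n = l]) (simp add: esym_0)
    finally have E: "?E (insert x P) (Suc l) = ?E P (Suc l) - p x * ?E P l" .
    have \<Pi>: "(\<Prod>x\<in>insert x P. 1 - p x) = (1 - p x) * ?\<Pi>"
      using insert by simp
    \<comment> \<open>The product obeys the same recursion as \<open>?E\<close>, so the signed error
      for \<open>insert x P\<close> is a nonnegative combination of the signed errors for
      \<open>P\<close> at levels \<open>Suc l\<close> and \<open>l\<close>; the minus sign before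
      \<open>p x\<close> is absorbed by the change of level.\<close>
    have "(-1) ^ Suc l * (?E (insert x P) (Suc l) - (\<Prod>x\<in>insert x P. 1 - p x)) =
        (-1) ^ Suc l * (?E P (Suc l) - ?\<Pi>) + p x * ((-1) ^ l * (?E P l - ?\<Pi>))"
      unfolding E \<Pi> by (simp add: algebra_simps)
    moreover have "0 \<le> (-1) ^ Suc l * (?E P (Suc l) - ?\<Pi>)" "0 \<le> (-1) ^ l * (?E P l - ?\<Pi>)"
      using insert.IH[of "Suc l"] insert.IH[of l] insert.prems by blast+
    moreover have "0 \<le> p x" using insert.prems by blast
    ultimately show ?thesis
      unfolding Suc by (simp only: add_nonneg_nonneg mult_nonneg_nonneg)
  qed
qed

section \<open>Size of the first omitted Bonferroni term\<close>

lemma power_add_mult_le: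
  fixes s a :: real
  assumes "0 \<le> s" "0 \<le> a"
  shows "s ^ Suc m + real (Suc m) * a * s ^ m \<le> (s + a) ^ Suc m"
proof (induction m)
  case (Suc m)
  \<comment> \<open>Both terms come from the binomial expansion. Multiplying out the right-hand side
    leaves the surplus \<open>real (Suc m) * a\<^sup>2 * s ^ m\<close>.\<close>
  have "s ^ Suc (Suc m) + real (Suc (Suc m)) * a * s ^ Suc m
      \<le> (s ^ Suc m + real (Suc m) * a * s ^ m) * (s + a)"
    using assms by (simp add: algebra_simps)
  also have "\<dots> \<le> (s + a) ^ Suc m * (s + a)"
    using Suc assms by (intro mult_right_mono) auto
  finally show ?case by (simp only: power_Suc2)
qed (use assms in auto)

text \<open>In the multinomial expansion of the power, each product over an \<open>m\<close>-element
  set occurs \<open>fact m\<close> times and all other terms are nonnegative. The proof reaches this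
  by induction on \<open>P\<close>.\<close>

lemma esym_le_power_sum:
  assumes "finite P" "\<And>x. x \<in> P \<Longrightarrow> 0 \<le> p x"
  shows "fact m * esym P p m \<le> sum p P ^ m"
  using assms
proof (induction P arbitrary: m rule: finite_induct)
  case empty
  then show ?case by (cases m) (auto simp: esym_0 esym_empty_Suc)
next
  case (insert x P)
  show ?case
  proof (cases m)
    case 0
    then show ?thesis using insert by (simp add: esym_0)
  next
    case (Suc l)
    have "fact m * esym (insert x P) p m =
        fact (Suc l) * esym P p (Suc l) + real (Suc l) * p x * (fact l * esym P p l)"
      using insert Suc by (simp add: esym_insert_Suc algebra_simps)
    also have "\<dots> \<le> sum p P ^ Suc l + real (Suc l) * p x * sum p P ^ l"
      using insert.IH[of "Suc l"] insert.IH[of l] insert.prems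
      by (intro add_mono mult_left_mono) auto
    also have "\<dots> \<le> (sum p P + p x) ^ Suc l"
      using insert.prems by (intro power_add_mult_le sum_nonneg) auto
    finally show ?thesis using insert Suc by (simp add: add.commute)
  qed
qed

text \<open>Pair the factors \<open>i\<close> and \<open>m + 1 - i\<close> of the two factorials:
  with \<open>i = Suc u\<close> and \<open>m = Suc u + v\<close> their product is
  \<open>m + u * v\<close>.\<close>

lemma power_self_le_fact_square: "m ^ m \<le> (fact m :: nat)\<^sup>2"
proof -
  have "m ^ m = (\<Prod>i\<in>{1..m}. m)" by simp
  also have "\<dots> \<le> (\<Prod>i\<in>{1..m}. i * (m + 1 - i))"
  proof (rule prod_mono)
    fix i assume "i \<in> {1..m}"
    then obtain u v where "i = Suc u" "m = Suc u + v"
      by (metis atLeastAtMost_iff le_Suc_ex not0_implies_Suc not_one_le_zero)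
    then show "0 \<le> m \<and> m \<le> i * (m + 1 - i)" by (simp add: algebra_simps)
  qed
  also have "\<dots> = (\<Prod>i\<in>{1..m}. i) * (\<Prod>i\<in>{1..m}. m + 1 - i)" by (rule prod.distrib)
  also have "(\<Prod>i\<in>{1..m}. m + 1 - i) = (\<Prod>i\<in>{1..m}. i)"
    by (rule prod.reindex_bij_witness[of _ "\<lambda>i. m + 1 - i" "\<lambda>i. m + 1 - i"]) auto
  finally show ?thesis by (simp add: power2_eq_square fact_prod)
qed

text \<open>Since \<open>sqrt m ^ m\<close> is at most \<open>fact m\<close>, the quotient is at
  most \<open>(\<epsilon> / 2) ^ m\<close>. It is applied with \<open>m = Suc C\<close> and
  \<open>s\<close> the sum of the block probabilities.\<close>

lemma power_div_fact_le:
  fixes s \<epsilon> :: real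
  assumes "0 \<le> s" "s \<le> \<epsilon> / 2 * sqrt (real m)" "0 \<le> \<epsilon>" "\<epsilon> \<le> 1" "2 \<le> m"
  shows "s ^ m / fact m \<le> \<epsilon> / 4"
proof -
  have "sqrt (real m) ^ m = sqrt (real (m ^ m))" by (simp add: real_sqrt_power)
  also have "\<dots> \<le> sqrt ((fact m)\<^sup>2)"
    using power_self_le_fact_square[of m]
    by (metis of_nat_fact of_nat_le_iff of_nat_power real_sqrt_le_iff)
  also have "\<dots> = fact m" by simp
  finally have f: "sqrt (real m) ^ m \<le> fact m" .
  have "s ^ m \<le> (\<epsilon> / 2 * sqrt (real m)) ^ m" using assms by (intro power_mono)
  also have "\<dots> = (\<epsilon> / 2) ^ m * sqrt (real m) ^ m" by (rule power_mult_distrib)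
  also have "\<dots> \<le> (\<epsilon> / 2) ^ m * fact m" using f assms by (intro mult_left_mono) auto
  finally have "s ^ m / fact m \<le> (\<epsilon> / 2) ^ m" by (simp add: divide_le_eq)
  also have "\<dots> \<le> (\<epsilon> / 2) ^ 2" using assms by (intro power_decreasing) auto
  also have "\<dots> \<le> \<epsilon> / 4"
    using assms by (simp add: power2_eq_square mult_left_le)
  finally show ?thesis .
qed

section \<open>From pointwise Bonferroni sums to counts in \<open>A\<close>\<close>

lemma finite_slice: "finite (slice A n)"
proof -
  have "slice A n \<subseteq> {xs. set xs \<subseteq> UNIV \<and> length xs = n}" by (auto simp: slice_def)
  then show ?thesis using finite_lists_length_eq[of "UNIV :: bool set" n] finite_subset by auto
qed

text \<open>A product of agreement indicators is the indicator of agreement on the union. Each term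
  of a Bonferroni sum thus becomes a count that independence controls.\<close>

lemma sum_prod_indicator_agreeing:
  assumes "finite K"
  shows "(\<Sum>a\<in>agreeing A n Q c. \<Prod>R\<in>K. of_bool (\<forall>i\<in>T R. a ! i = c ! i)) =
    real (card (agreeing A n (Q \<union> (\<Union>R\<in>K. T R)) c))"
proof -
  have fin: "finite (agreeing A n Q c)" by (simp add: agreeing_def finite_slice)
  have "(\<Prod>R\<in>K. of_bool (\<forall>i\<in>T R. a ! i = c ! i)) =
      (of_bool (\<forall>R\<in>K. \<forall>i\<in>T R. a ! i = c ! i) :: real)" for a
    using assms by (induction K rule: finite_induct) (auto simp: of_bool_conj)
  then have "(\<Sum>a\<in>agreeing A n Q c. \<Prod>R\<in>K. of_bool (\<forall>i\<in>T R. a ! i = c ! i)) =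
      (\<Sum>a\<in>agreeing A n Q c. of_bool (\<forall>R\<in>K. \<forall>i\<in>T R. a ! i = c ! i) :: real)"
    by simp
  also have "\<dots> = real (card {a \<in> agreeing A n Q c. \<forall>R\<in>K. \<forall>i\<in>T R. a ! i = c ! i})"
    using fin by (simp add: sum.If_cases of_bool_def Int_def)
  also have "{a \<in> agreeing A n Q c. \<forall>R\<in>K. \<forall>i\<in>T R. a ! i = c ! i} =
      agreeing A n (Q \<union> (\<Union>R\<in>K. T R)) c"
    by (auto simp: agreeing_def)
  finally show ?thesis .
qed

text \<open>If no string worked, averaging the truncated Bonferroni sum over \<open>A\<close> would
  give at most 0. The same sum for the block probabilities is bounded below by the numerator in
  \<open>gain\<close>, and each index set \<open>K\<close> changes it by at most \<delta> in passing
  to \<open>A\<close>, contradicting \<open>gain\<close>.\<close>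

lemma exists_avoiding:
  fixes T :: "'a \<Rightarrow> nat set" and \<delta> :: real
  assumes indep: "\<And>S. S \<subseteq> {..<n} \<Longrightarrow> card S \<le> k \<Longrightarrow>
      \<bar>real (card (agreeing A n S c)) / real (card (slice A n)) - 1 / 2 ^ card S\<bar> \<le> \<delta>"
    and "odd C" "finite P" "Q \<subseteq> {..<n}"
    and T: "\<And>R. R \<in> P \<Longrightarrow> T R \<subseteq> {..<n} - Q" "disjoint_family_on T P"
    and t: "\<And>R. R \<in> P \<Longrightarrow> card (T R) \<le> t" "card Q + C * t \<le> k"
    and gain: "\<delta> * (\<Sum>k\<le>C. real (card P choose k)) <
      ((\<Prod>R\<in>P. 1 - 1 / 2 ^ card (T R)) - esym P (\<lambda>R. 1 / 2 ^ card (T R)) (Suc C)) / 2 ^ card Q"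
  shows "\<exists>a\<in>slice A n. (\<forall>i\<in>Q. a ! i = c ! i) \<and> (\<forall>R\<in>P. \<exists>i\<in>T R. a ! i \<noteq> c ! i)"
proof (rule ccontr)
  assume no: "\<not> ?thesis"
  define p :: "'a \<Rightarrow> real" where "p R = 1 / 2 ^ card (T R)" for R
  define b :: "bool list \<Rightarrow> 'a \<Rightarrow> real" where "b a R = of_bool (\<forall>i\<in>T R. a ! i = c ! i)" for a R
  define N where "N = real (card (slice A n))"
  define F where "F K = real (card (agreeing A n (Q \<union> (\<Union>R\<in>K. T R)) c)) / N" for K
  let ?S = "\<lambda>j. {K. K \<subseteq> P \<and> card K = j}"
  have finT: "finite (T R)" if "R \<in> P" for R using T(1)[OF that] finite_subset by blast
  have finQ: "finite Q" using assms finite_subset by blast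
  have F: "\<bar>F K - prod p K / 2 ^ card Q\<bar> \<le> \<delta>" if K: "K \<subseteq> P" "card K \<le> C" for K
  proof -
    have finK: "finite K" using K assms finite_subset by blast
    have cU: "card (\<Union>R\<in>K. T R) = (\<Sum>R\<in>K. card (T R))"
    proof (rule card_UN_disjoint)
      show "\<forall>R\<in>K. \<forall>R'\<in>K. R \<noteq> R' \<longrightarrow> T R \<inter> T R' = {}"
        using T(2) K unfolding disjoint_family_on_def by blast
    qed (use finK finT K in auto)
    have c: "card (Q \<union> (\<Union>R\<in>K. T R)) = card Q + (\<Sum>R\<in>K. card (T R))"
      unfolding cU[symmetric] using finQ finK finT K T(1)
      by (intro card_Un_disjoint finite_UN_I) auto
    have "(\<Sum>R\<in>K. card (T R)) \<le> card K * t"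
      using K t sum_bounded_above[of K "\<lambda>R. card (T R)" t] by auto
    also have "\<dots> \<le> C * t" using K by simp
    finally have "card (Q \<union> (\<Union>R\<in>K. T R)) \<le> k" using c t by linarith
    moreover have "Q \<union> (\<Union>R\<in>K. T R) \<subseteq> {..<n}" using K T assms by blast
    moreover have "1 / 2 ^ card (Q \<union> (\<Union>R\<in>K. T R)) = prod p K / 2 ^ card Q"
      by (simp add: c p_def power_add power_sum prod_dividef)
    ultimately show ?thesis using indep[of "Q \<union> (\<Union>R\<in>K. T R)"] by (simp add: F_def N_def)
  qed
  \<comment> \<open>By \<open>no\<close>, a string agreeing on \<open>Q\<close> also agrees on some
    whole \<open>T R\<close>, so the indicator product vanishes; at the odd level \<open>C\<close>
    the truncated sum lies below it.\<close>
  have E: "(\<Sum>j\<le>C. (-1) ^ j * esym P (b a) j) \<le> 0" if a: "a \<in> agreeing A n Q c" for a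
  proof -
    from a no obtain R where "R \<in> P" "\<forall>i\<in>T R. a ! i = c ! i"
      by (auto simp: agreeing_def)
    then have "(\<Prod>R\<in>P. 1 - b a R) = 0"
      using \<open>finite P\<close> by (auto simp: b_def)
    moreover have "0 \<le> (-1) ^ C * ((\<Sum>j\<le>C. (-1) ^ j * esym P (b a) j) - (\<Prod>R\<in>P. 1 - b a R))"
      using \<open>finite P\<close> by (rule bonferroni) (simp add: b_def)
    ultimately show ?thesis using \<open>odd C\<close> by simp
  qed
  have "(\<Sum>j\<le>C. (-1) ^ j * (\<Sum>K\<in>?S j. F K)) =
      (\<Sum>a\<in>agreeing A n Q c. \<Sum>j\<le>C. (-1) ^ j * esym P (b a) j) / N"
  proof -
    have "(\<Sum>a\<in>agreeing A n Q c. esym P (b a) j) / N = (\<Sum>K\<in>?S j. F K)" for j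
    proof -
      have "(\<Sum>a\<in>agreeing A n Q c. esym P (b a) j) =
          (\<Sum>K\<in>?S j. \<Sum>a\<in>agreeing A n Q c. prod (b a) K)"
        unfolding esym_def by (rule sum.swap)
      also have "\<dots> = (\<Sum>K\<in>?S j. real (card (agreeing A n (Q \<union> (\<Union>R\<in>K. T R)) c)))"
        unfolding b_def
        by (intro sum.cong refl sum_prod_indicator_agreeing) (use assms finite_subset in auto)
      finally show ?thesis by (simp add: F_def sum_divide_distrib)
    qed
    moreover have "(\<Sum>a\<in>agreeing A n Q c. \<Sum>j\<le>C. (-1) ^ j * esym P (b a) j) / N =
        (\<Sum>j\<le>C. (-1) ^ j * ((\<Sum>a\<in>agreeing A n Q c. esym P (b a) j) / N))"
      by (subst sum.swap) (simp add: sum_divide_distrib sum_distrib_left)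
    ultimately show ?thesis by simp
  qed
  also have "\<dots> \<le> 0"
  \<comment> \<open>Only \<open>0 \<le> N\<close> is asked for; an empty slice is covered by
    division by zero giving 0.\<close>
  proof (rule divide_nonpos_nonneg)
    show "(\<Sum>a\<in>agreeing A n Q c. \<Sum>j\<le>C. (-1) ^ j * esym P (b a) j) \<le> 0"
      by (rule sum_nonpos) (rule E)
  qed (simp add: N_def)
  finally have upper: "(\<Sum>j\<le>C. (-1) ^ j * (\<Sum>K\<in>?S j. F K)) \<le> 0" .
  have "(\<Sum>j\<le>C. (-1) ^ j * esym P p j) / 2 ^ card Q - \<delta> * (\<Sum>j\<le>C. real (card P choose j))
      = (\<Sum>j\<le>C. (-1) ^ j * (esym P p j / 2 ^ card Q) - \<delta> * real (card P choose j))"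
    by (simp add: sum_subtractf sum_divide_distrib sum_distrib_left)
  also have "\<dots> \<le> (\<Sum>j\<le>C. (-1) ^ j * (\<Sum>K\<in>?S j. F K))"
  proof (rule sum_mono)
    fix j assume j: "j \<in> {..C}"
    have "\<bar>(\<Sum>K\<in>?S j. F K) - esym P p j / 2 ^ card Q\<bar> =
        \<bar>\<Sum>K\<in>?S j. F K - prod p K / 2 ^ card Q\<bar>"
      by (simp add: esym_def sum_subtractf sum_divide_distrib)
    also have "\<dots> \<le> (\<Sum>K\<in>?S j. \<bar>F K - prod p K / 2 ^ card Q\<bar>)" by (rule sum_abs)
    also have "\<dots> \<le> (\<Sum>K\<in>?S j. \<delta>)" using F j by (intro sum_mono) auto
    also have "\<dots> = \<delta> * real (card P choose j)" using \<open>finite P\<close> by (simp add: n_subsets)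
    finally have "\<bar>(\<Sum>K\<in>?S j. F K) - esym P p j / 2 ^ card Q\<bar> \<le> \<delta> * real (card P choose j)" .
    then show "(-1) ^ j * (esym P p j / 2 ^ card Q) - \<delta> * real (card P choose j)
        \<le> (-1) ^ j * (\<Sum>K\<in>?S j. F K)"
      by (cases "even j") (auto simp: abs_le_iff)
  qed
  finally have "(\<Sum>j\<le>C. (-1) ^ j * esym P p j) / 2 ^ card Q \<le> \<delta> * (\<Sum>j\<le>C. real (card P choose j))"
    using upper by linarith
  \<comment> \<open>The level \<open>Suc C\<close> is even, so there the sum bounds the product from
    above; its last term has positive sign and is moved to the left.\<close>
  moreover have "(\<Prod>R\<in>P. 1 - p R) - esym P p (Suc C) \<le> (\<Sum>j\<le>C. (-1) ^ j * esym P p j)"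
    using bonferroni[of P p "Suc C"] assms by (simp add: p_def)
  then have "((\<Prod>R\<in>P. 1 - p R) - esym P p (Suc C)) / 2 ^ card Q
      \<le> (\<Sum>j\<le>C. (-1) ^ j * esym P p j) / 2 ^ card Q"
    by (intro divide_right_mono) auto
  ultimately show False using gain unfolding p_def by linarith
qed

section \<open>Cutting the blocks of a partition\<close>

lemma sum_le_neg_ln_prod:
  fixes p :: "'a \<Rightarrow> real"
  assumes "finite P" "\<And>x. x \<in> P \<Longrightarrow> p x < 1"
  shows "sum p P \<le> - ln (\<Prod>x\<in>P. 1 - p x)"
proof -
  \<comment> \<open>Multiply \<open>1 - x \<le> exp (- x)\<close> over \<open>P\<close>.\<close>
  have "(\<Prod>x\<in>P. 1 - p x) \<le> exp (- sum p P)"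
  proof -
    have "(\<Prod>x\<in>P. 1 - p x) \<le> (\<Prod>x\<in>P. exp (- p x))"
    proof (rule prod_mono)
      fix x assume "x \<in> P"
      then show "0 \<le> 1 - p x \<and> 1 - p x \<le> exp (- p x)"
        using assms(2)[of x] exp_ge_add_one_self[of "- p x"] by auto
    qed
    then show ?thesis using assms by (simp add: exp_sum sum_negf[symmetric])
  qed
  moreover have "0 < (\<Prod>x\<in>P. 1 - p x)" using assms by (intro prod_pos) auto
  ultimately have "ln (\<Prod>x\<in>P. 1 - p x) \<le> - sum p P"
    by (metis ln_exp ln_mono)
  then show ?thesis by simp
qed

text \<open>Disjoint blocks inside \<open>{..<n}\<close> have total size at most \<open>n\<close>.
  This bounds the number of cut blocks and, with \<open>t = 1\<close>, the number of all
  blocks.\<close>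

lemma mult_card_le_of_partition_on:
  assumes "partition_on I P" "I \<subseteq> {..<n}" "B \<subseteq> P" "\<And>R. R \<in> B \<Longrightarrow> t \<le> card R"
  shows "t * card B \<le> n"
proof -
  have UB: "\<Union>B \<subseteq> {..<n}" using assms by (auto simp: partition_on_def)
  have "t * card B \<le> (\<Sum>R\<in>B. card R)"
    using sum_bounded_below[of B t card] assms(4) by (simp add: mult.commute)
  also have "\<dots> = card (\<Union>B)"
  proof (rule card_Union_disjoint[symmetric])
    show "pairwise disjnt B"
      using assms(1,3) unfolding partition_on_def disjoint_def pairwise_def disjnt_def by blast
    show "finite R" if "R \<in> B" for R
      using that UB by (meson Sup_le_iff finite_lessThan finite_subset)
  qed
  also have "\<dots> \<le> n"
    using card_mono[OF _ UB] by simp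
  finally show ?thesis .
qed

text \<open>Only the blocks in \<open>B\<close>, longer than \<open>t\<close>, change. There are at
  most \<open>n / t\<close> of them, each of new probability \<open>1 / 2 ^ t \<le> 1 / n\<close>,
  so they add at most \<open>1 / t\<close> to the sum. The blocks in \<open>D\<close> keep their
  probabilities and are controlled by the given product.\<close>

lemma truncated_blocks:
  fixes \<epsilon> :: real
  assumes P: "partition_on I P" "I \<subseteq> {..<n}"
    and \<epsilon>: "0 < \<epsilon>" "\<epsilon> \<le> (\<Prod>R\<in>P. 1 - 1 / 2 ^ card R)"
    and t: "real n \<le> 2 ^ t" "2 \<le> t"
  shows "(\<Sum>R\<in>P. 1 / 2 ^ min (card R) t) \<le> ln (1 / \<epsilon>) + 1 / real t"
    and "\<epsilon> / 2 \<le> (\<Prod>R\<in>P. 1 - 1 / 2 ^ min (card R) t)"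
proof -
  define B where "B = {R \<in> P. t < card R}"
  define D where "D = P - B"
  have finI: "finite I" using P finite_subset by blast
  have finP: "finite P" using P finI by (metis finite_UnionD partition_onD1)
  have finR: "finite R" if "R \<in> P" for R using that P finI by (metis Union_upper finite_subset partition_onD1)
  have pos: "0 < card R" if "R \<in> P" for R
    using that P finR by (metis card_gt_0_iff partition_onD3)
  have BP: "B \<subseteq> P" by (auto simp: B_def)
  have PDB: "P = D \<union> B" "D \<inter> B = {}" by (auto simp: D_def B_def)
  have finBD: "finite B" "finite D" using finP by (auto simp: B_def D_def)
  have le1: "1 / 2 ^ j < (1::real)" if "0 < j" for j :: nat
    using that by (simp add: one_less_power)
  have "t * card B \<le> n"
    using P BP by (intro mult_card_le_of_partition_on[OF P]) (auto simp: B_def)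
  then have tB: "real t * real (card B) \<le> real n"
    by (metis of_nat_le_iff of_nat_mult)
  have "(\<Sum>R\<in>B. 1 / 2 ^ min (card R) t) = real (card B) / 2 ^ t"
    by (simp add: B_def)
  also have "\<dots> \<le> 1 / real t"
    using order_trans[OF tB t(1)] t(2) by (simp add: field_simps)
  finally have sumB: "(\<Sum>R\<in>B. 1 / 2 ^ min (card R) t) \<le> 1 / real t" .
  have minD: "min (card R) t = card R" if "R \<in> D" for R using that by (auto simp: D_def B_def)
  have prodP: "(\<Prod>R\<in>P. 1 - 1 / 2 ^ card R) = (\<Prod>R\<in>D. 1 - 1 / 2 ^ card R) * (\<Prod>R\<in>B. 1 - 1 / 2 ^ card R :: real)"
    using PDB finBD by (metis prod.union_disjoint)
  have "(\<Prod>R\<in>B. 1 - 1 / 2 ^ card R :: real) \<le> 1"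
    by (intro prod_le_1) auto
  moreover have "(0::real) \<le> (\<Prod>R\<in>D. 1 - 1 / 2 ^ card R)"
    by (intro prod_nonneg) auto
  ultimately have "(\<Prod>R\<in>D. 1 - 1 / 2 ^ card R) * (\<Prod>R\<in>B. 1 - 1 / 2 ^ card R) \<le> (\<Prod>R\<in>D. 1 - 1 / 2 ^ card R :: real)"
    by (rule mult_left_le)
  \<comment> \<open>Dropping the factors of \<open>B\<close>, each at most 1, cannot lower the
    product.\<close>
  then have \<epsilon>D: "\<epsilon> \<le> (\<Prod>R\<in>D. 1 - 1 / 2 ^ card R)"
    using \<epsilon>(2) unfolding prodP by (rule order_trans[rotated])
  have "(\<Sum>R\<in>D. 1 / 2 ^ card R) \<le> - ln (\<Prod>R\<in>D. 1 - 1 / 2 ^ card R :: real)"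
    using pos le1 finBD by (intro sum_le_neg_ln_prod) (auto simp: D_def)
  also have "\<dots> \<le> - ln \<epsilon>" using \<epsilon>D \<epsilon> by simp
  also have "\<dots> = ln (1 / \<epsilon>)" using \<epsilon> by (simp add: ln_div)
  finally have sumD: "(\<Sum>R\<in>D. 1 / 2 ^ card R :: real) \<le> ln (1 / \<epsilon>)" .
  have "(\<Sum>R\<in>P. 1 / 2 ^ min (card R) t :: real) =
      (\<Sum>R\<in>D. 1 / 2 ^ card R) + (\<Sum>R\<in>B. 1 / 2 ^ min (card R) t)"
    using PDB finBD minD by (simp add: sum.union_disjoint)
  then show "(\<Sum>R\<in>P. 1 / 2 ^ min (card R) t) \<le> ln (1 / \<epsilon>) + 1 / real t"
    using sumB sumD by linarith
  have "1 / real t \<le> 1 / 2" using t by (simp add: field_simps)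
  then have "1 / 2 \<le> 1 - (\<Sum>R\<in>B. 1 / 2 ^ min (card R) t :: real)"
    using sumB by linarith
  also have "\<dots> \<le> (\<Prod>R\<in>B. 1 - 1 / 2 ^ min (card R) t)"
  proof -
    let ?p = "\<lambda>R. 1 / 2 ^ min (card R) t :: real"
    \<comment> \<open>Bonferroni at level 1 is the Weierstrass inequality: the product is at least 1
      minus the sum, here at least one half.\<close>
    have "esym B ?p 1 \<le> sum ?p B"
      using esym_le_power_sum[of B ?p 1] finBD by simp
    moreover have "1 - esym B ?p 1 \<le> (\<Prod>R\<in>B. 1 - ?p R)"
      using bonferroni[of B ?p 1] finBD by (simp add: esym_0)
    ultimately show ?thesis by linarith
  qed
  finally have "\<epsilon> * (1 / 2) \<le> (\<Prod>R\<in>D. 1 - 1 / 2 ^ card R) * (\<Prod>R\<in>B. 1 - 1 / 2 ^ min (card R) t)"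
    using \<epsilon> \<epsilon>D by (intro mult_mono) auto
  also have "\<dots> = (\<Prod>R\<in>P. 1 - 1 / 2 ^ min (card R) t)"
    using PDB finBD minD by (simp add: prod.union_disjoint)
  finally show "\<epsilon> / 2 \<le> (\<Prod>R\<in>P. 1 - 1 / 2 ^ min (card R) t)" by simp
qed

section \<open>Choice of the threshold for \<open>n\<close> and assembly of the estimates\<close>

theorem theorem2:
  fixes \<epsilon> :: real and C :: nat and \<beta> :: "nat \<Rightarrow> real" and A :: "bool list set"
  assumes "\<epsilon> > 0"
    and "C = (LEAST m::nat. odd m \<and> real m > (2 / \<epsilon> * ln (1 / \<epsilon>))\<^sup>2)"
    and "\<And>n::nat. n \<ge> 1 \<Longrightarrow> 0 < \<beta> n \<and> \<beta> n < 1 / real n ^ (C + 3)"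
    and "wise_independent (\<lambda>n. nat \<lceil>(real C + 2) * log 2 (real n)\<rceil>) \<beta> A"
  shows "rich \<epsilon> A"
proof -
  define L where "L = ln (1 / \<epsilon>)"
  have "\<exists>m::nat. odd m \<and> real m > (2 / \<epsilon> * L)\<^sup>2"
  proof -
    obtain j :: nat where "(2 / \<epsilon> * L)\<^sup>2 < real j" using reals_Archimedean2 by blast
    then have "odd (2 * j + 1) \<and> real (2 * j + 1) > (2 / \<epsilon> * L)\<^sup>2" by simp
    then show ?thesis by blast
  qed
  then have C: "odd C" "(2 / \<epsilon> * L)\<^sup>2 < real C"
    unfolding assms(2) L_def by (metis (mono_tags, lifting) LeastI_ex)+
  have "\<bar>2 / \<epsilon> * L\<bar> < sqrt (real (Suc C))"
    by (intro real_less_rsqrt, unfold power2_abs) (use C(2) in simp)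
  then have "2 / \<epsilon> * L < sqrt (real (Suc C))" by linarith
  then have gap: "0 < \<epsilon> / 2 * sqrt (real (Suc C)) - L"
    using assms(1) by (simp add: field_simps)
  \<comment> \<open>The positive slack between \<open>L\<close> and the bound required by
    \<open>power_div_fact_le\<close>; it has to absorb the \<open>1 / t\<close> caused by
    cutting.\<close>
  define \<gamma> where "\<gamma> = \<epsilon> / 2 * sqrt (real (Suc C)) - L"
  \<comment> \<open>As a lower bound on \<open>log 2 n\<close>, the three entries serve in turn to
    absorb rounding in \<open>C * t\<close>, to give \<open>2 \<le> t\<close>, and to give
    \<open>1 / t \<le> \<gamma>\<close>.\<close>
  define X where "X = max (max (real C) 2) (1 / \<gamma>)"
  have "\<forall>\<^sub>F n in sequentially. 2 powr X \<le> real n"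
    using filterlim_real_sequentially by (simp add: filterlim_at_top)
  then have ev1: "\<forall>\<^sub>F n in sequentially. X \<le> log 2 (real n)"
  proof eventually_elim
    case (elim n)
    moreover from this have "0 < real n" by (rule less_le_trans[rotated]) simp
    ultimately show ?case by (simp add: le_log_iff)
  qed
  \<comment> \<open>This threshold makes the total error \<open>(C + 1) / n ^ 3\<close> smaller than
    \<open>\<epsilon> / (4 * n)\<close>.\<close>
  have ev2: "\<forall>\<^sub>F n in sequentially. 4 * (real C + 1) / \<epsilon> < real n"
    using filterlim_real_sequentially by (simp add: filterlim_at_top_dense)
  have ev3: "\<forall>\<^sub>F n in sequentially. (1::nat) \<le> n" by (rule eventually_ge_at_top)
  show ?thesis
    unfolding rich_def
    using ev1 ev2 ev3 assms(4)[unfolded wise_independent_def]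
  proof eventually_elim
    case (elim n)
    show ?case
    proof (intro allI impI)
      fix I Q :: "nat set" and P and c :: "bool list"
      assume I: "I \<subseteq> {..<n}" and P: "partition_on I P"
        and \<epsilon>P: "\<epsilon> \<le> (\<Prod>R\<in>P. 1 - 1 / 2 ^ card R)"
        and Q: "Q \<subseteq> {..<n} - I" "real (card Q) \<le> log 2 (real n)" and c: "length c = n"
      define t where "t = nat \<lceil>log 2 (real n)\<rceil>"
      have X: "real C \<le> log 2 (real n)" "2 \<le> log 2 (real n)" "1 / \<gamma> \<le> log 2 (real n)"
        using elim(1) by (auto simp: X_def)
      have tl: "log 2 (real n) \<le> real t" "real t \<le> log 2 (real n) + 1"
        using X by (auto simp: t_def)
      have t2: "2 \<le> t" using X tl by linarith
      have nt: "real n \<le> 2 ^ t"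
        using tl(1) elim(3) by (simp add: log_le_iff powr_realpow)
      \<comment> \<open>A product of factors at most 1 reaches \<epsilon>, so larger values of
        \<epsilon> are vacuous.\<close>
      have \<epsilon>1: "\<epsilon> \<le> 1"
      proof -
        have "(\<Prod>R\<in>P. 1 - 1 / 2 ^ card R :: real) \<le> 1" by (intro prod_le_1) auto
        then show ?thesis using \<epsilon>P by simp
      qed
      have finI: "finite I" using I finite_subset by blast
      have finP: "finite P" using P finI by (metis finite_UnionD partition_onD1)
      have "finite R \<and> R \<noteq> {}" if "R \<in> P" for R
        using that P finI by (metis Union_upper finite_subset partition_onD1 partition_onD3)
      then have posP: "1 \<le> card R" if "R \<in> P" for R
        using that by (simp add: Suc_leI card_gt_0_iff)
      have cardP: "card P \<le> n"
        using mult_card_le_of_partition_on[OF P I order_refl, of 1] posP by simp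
      have "\<exists>T. \<forall>R\<in>P. T R \<subseteq> R \<and> card (T R) = min (card R) t"
        by (intro bchoice ballI) (metis min.cobounded1 obtain_subset_with_card_n)
      then obtain T where T: "\<And>R. R \<in> P \<Longrightarrow> T R \<subseteq> R" "\<And>R. R \<in> P \<Longrightarrow> card (T R) = min (card R) t"
        by blast
      note trunc = truncated_blocks[OF P I assms(1) \<epsilon>P nt t2]
      have esym: "esym P (\<lambda>R. 1 / 2 ^ card (T R)) (Suc C) \<le> \<epsilon> / 4"
      proof -
        let ?s = "\<Sum>R\<in>P. 1 / 2 ^ card (T R) :: real"
        have s0: "0 \<le> ?s" by (intro sum_nonneg) auto
        have "1 / real t \<le> \<gamma>"
        proof -
          have "1 / \<gamma> \<le> real t" using tl(1) X(3) by linarith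
          moreover have "0 < \<gamma>" using gap by (simp only: \<gamma>_def)
          ultimately show ?thesis using t2 by (simp add: field_simps)
        qed
        then have "?s \<le> \<epsilon> / 2 * sqrt (real (Suc C))"
          using trunc(1) T(2) by (simp add: L_def[symmetric] \<gamma>_def)
        moreover have "2 \<le> Suc C" using C(1) by (cases C) auto
        ultimately have "?s ^ Suc C / fact (Suc C) \<le> \<epsilon> / 4"
          using s0 \<epsilon>1 assms(1) by (intro power_div_fact_le) auto
        moreover have "esym P (\<lambda>R. 1 / 2 ^ card (T R)) (Suc C) \<le> ?s ^ Suc C / fact (Suc C)"
          using esym_le_power_sum[OF finP, of "\<lambda>R. 1 / 2 ^ card (T R)" "Suc C"]
          by (simp add: pos_le_divide_eq mult.commute del: fact_Suc)
        ultimately show ?thesis by linarith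
      qed
      have prod: "\<epsilon> / 2 \<le> (\<Prod>R\<in>P. 1 - 1 / 2 ^ card (T R))"
        using trunc(2) T(2) by simp
      \<comment> \<open>Fixing the positions in \<open>Q\<close> costs at most a factor
        \<open>n\<close> in probability.\<close>
      have Qn: "2 ^ card Q \<le> real n"
        using Q(2) elim(3) by (simp add: le_log_iff powr_realpow)
      \<comment> \<open>There are \<open>C + 1\<close> binomial coefficients, each at most
        \<open>n ^ C\<close>.\<close>
      have "\<beta> n * (\<Sum>k\<le>C. real (card P choose k)) \<le> 1 / real n ^ (C + 3) * ((real C + 1) * real n ^ C)"
      proof (rule mult_mono)
        have "real (card P choose k) \<le> real n ^ C" if "k \<le> C" for k
        proof -
          have "card P choose k \<le> (card P choose k) * fact k" by simp
          also have "\<dots> \<le> card P ^ k" by (rule binomial_fact_pow)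
          also have "\<dots> \<le> n ^ k" using cardP by (rule power_mono) simp
          also have "\<dots> \<le> n ^ C" using that elim(3) by (intro power_increasing) auto
          finally show ?thesis by (metis of_nat_le_iff of_nat_power)
        qed
        then have "(\<Sum>k\<le>C. real (card P choose k)) \<le> (\<Sum>k\<le>C. real n ^ C)"
          by (intro sum_mono) auto
        then show "(\<Sum>k\<le>C. real (card P choose k)) \<le> (real C + 1) * real n ^ C"
          by (simp add: add.commute)
      qed (use assms(3)[OF elim(3)] in \<open>auto intro: sum_nonneg\<close>)
      also have "\<dots> = (real C + 1) / real n ^ 3"
        using elim(3) by (simp add: power_add field_simps)
      also have "\<dots> < (\<epsilon> / 4) / real n"
      proof -
        have "4 * (real C + 1) < \<epsilon> * real n" using elim(2) assms(1) by (simp add: field_simps)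
        also have "\<dots> \<le> \<epsilon> * (real n)\<^sup>2"
          using elim(3) assms(1) by (simp add: power2_eq_square)
        finally have "(real C + 1) / (real n)\<^sup>2 < \<epsilon> / 4"
          using elim(3) by (simp add: field_simps)
        then have "(real C + 1) / (real n)\<^sup>2 / real n < \<epsilon> / 4 / real n"
          using elim(3) by (intro divide_strict_right_mono) auto
        then show ?thesis by (simp add: power2_eq_square power3_eq_cube)
      qed
      also have "\<dots> \<le> (\<epsilon> / 4) / 2 ^ card Q"
        using Qn elim(3) assms(1) by (intro divide_left_mono) auto
      \<comment> \<open>The product is at least \<open>\<epsilon> / 2\<close> and the omitted term
        at most \<open>\<epsilon> / 4\<close>.\<close>
      also have "\<dots> \<le> ((\<Prod>R\<in>P. 1 - 1 / 2 ^ card (T R)) - esym P (\<lambda>R. 1 / 2 ^ card (T R)) (Suc C)) / 2 ^ card Q"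
        using esym prod by (intro divide_right_mono) auto
      finally have gain: "\<beta> n * (\<Sum>k\<le>C. real (card P choose k)) < \<dots>" .
      \<comment> \<open>Rounding up in \<open>t\<close> costs at most \<open>C \<le> log 2 n\<close>
        in total; \<open>Q\<close> accounts for the second extra logarithm in
        \<open>C + 2\<close>.\<close>
      have "card Q + C * t \<le> nat \<lceil>(real C + 2) * log 2 (real n)\<rceil>"
      proof -
        have "real C * real t \<le> real C * (log 2 (real n) + 1)" using tl by (intro mult_left_mono) auto
        then have "real (card Q + C * t) \<le> (real C + 2) * log 2 (real n)"
          using Q(2) X(1) by (simp add: algebra_simps)
        then show ?thesis by linarith
      qed
      moreover have "disjoint_family_on T P"
        using P T(1) unfolding partition_on_def disjoint_def disjoint_family_on_def by blast
      moreover have "T R \<subseteq> {..<n} - Q" if "R \<in> P" for R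
        using T(1)[OF that] that P I Q(1) by (auto simp: partition_on_def)
      ultimately have "\<exists>a\<in>slice A n. (\<forall>i\<in>Q. a ! i = c ! i) \<and> (\<forall>R\<in>P. \<exists>i\<in>T R. a ! i \<noteq> c ! i)"
        using elim(4) c C(1) finP Q(1) T(2) gain by (intro exists_avoiding) auto
      then obtain a where a: "a \<in> slice A n" "\<forall>i\<in>Q. a ! i = c ! i"
        and "\<And>R. R \<in> P \<Longrightarrow> \<exists>i\<in>T R. a ! i \<noteq> c ! i" by blast
      then have "\<forall>R\<in>P. \<exists>i\<in>R. a ! i \<noteq> c ! i"
        using T(1) by (meson subsetD)
      then show "\<exists>a\<in>slice A n. (\<forall>i\<in>Q. a ! i = c ! i) \<and> (\<forall>R\<in>P. \<exists>i\<in>R. a ! i \<noteq> c ! i)"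
        using a by blast
    qed
  qed
qed

end
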